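(* Let $\mathcal{A}\in\mathbb{C}^{n_1\times n_2\times n_3}$. Suppose $\mathcal{A}$ has the C-full rank decomposition $\mathcal{A}=\mathcal{M}*_c\mathcal{N}$. Then $$\mathcal{A}^\dagger=\mathcal{N}^H*_c(\mathcal{M}^H*_c\mathcal{A}*_c\mathcal{N}^H)^{-1}*_c\mathcal{M}^H.$$
   Context: For a third-order tensor $\mathcal{A}\in\mathbb{C}^{n_1\times n_2\times n_3}$, $\mathcal{A}^{(i)}=\mathcal{A}(:,:,i)\in\mathbb{C}^{n_1\times n_2}$ denotes its $i$-th frontal slice. Let $\mathbf{C}_{n_3}$ be the $n_3\times n_3$ orthogonal DCT matrix, with entries $(\mathbf{C}_{n_3})_{jk}=\sqrt{(2-\delta_{j1})/n_3}\,\cos\big(\tfrac{(j-1)(2k-1)\pi}{2n_3}\big)$; let $\mathbf{W}$ be the diagonal matrix whose diagonal is the first column of $\mathbf{C}_{n_3}$; let $\mathbf{Z}$ be the $n_3\times n_3$ matrix with ones on the first superdiagonal and zeros elsewhere; and put $\mathbf{M}=\mathbf{W}^{-1}\mathbf{C}_{n_3}(\mathbf{I}+\mathbf{Z})$, an invertible matrix. Define the linear bijection $L$ on tensors with third dimension $n_3$ by $L(\mathcal{A})_{ijk}=\sum_{l=1}^{n_3}\mathbf{M}_{kl}\mathcal{A}_{ijl}$. The C-product of $\mathcal{A}\in\mathbb{C}^{n_1\times n_2\times n_3}$ and $\mathcal{B}\in\mathbb{C}^{n_2\times l\times n_3}$ is the tensor $\mathcal{A}*_c\mathcal{B}\in\mathbb{C}^{n_1\times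 l\times n_3}$ determined by $L(\mathcal{A}*_c\mathcal{B})^{(i)}=L(\mathcal{A})^{(i)}L(\mathcal{B})^{(i)}$, $i=1,\dots,n_3$. The conjugate transpose $\mathcal{A}^H$ is determined by $L(\mathcal{A}^H)^{(i)}=(L(\mathcal{A})^{(i)})^H$ for all $i$. The identity tensor $\mathcal{I}\in\mathbb{C}^{n\times n\times n_3}$ is determined by $L(\mathcal{I})^{(i)}=\mathbf{I}_n$ for all $i$. The inverse $\mathcal{B}^{-1}$ of $\mathcal{B}\in\mathbb{C}^{n\times n\times n_3}$ is the tensor with $\mathcal{B}*_c\mathcal{B}^{-1}=\mathcal{B}^{-1}*_c\mathcal{B}=\mathcal{I}$; a formula containing an inverse includes the assertion that the inverse exists. A C-full rank decomposition of $\mathcal{A}\in\mathbb{C}^{n_1\times n_2\times n_3}$ is a factorization $\mathcal{A}=\mathcal{M}*_c\mathcal{N}$ with $\mathcal{M}\in\mathbb{C}^{n_1\times r\times n_3}$, $\mathcal{N}\in\mathbb{C}^{r\times n_2\times n_3}$ (for some $r$) such that, for every $i=1,\dots,n_3$, $L(\mathcal{M})^{(i)}\in\mathbb{C}^{n_1\times r}$ and $L(\mathcal{N})^{(i)}\in\mathbb{C}^{r\times n_2}$ both have rank $r$ (not every tensor has one). The Moore-Penrose inverse $\mathcal{A}^\dagger$ is the (unique) tensor $\mathcal{X}\in\mathbb{C}^{n_2\times n_1\times n_3}$ with $\mathcal{A}*_c\mathcal{X}*_c\mathcal{A}=\mathcal{A}$, $\mathcal{X}*_c\mathcal{A}*_c\mathcal{X}=\mathcal{X}$,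 $(\mathcal{A}*_c\mathcal{X})^H=\mathcal{A}*_c\mathcal{X}$, $(\mathcal{X}*_c\mathcal{A})^H=\mathcal{X}*_c\mathcal{A}$. *)

theory Defs
  imports
    Complex_Main
    "Jordan_Normal_Form.Gauss_Jordan_Elimination"
    "Jordan_Normal_Form.Schur_Decomposition"
    "Jordan_Normal_Form.DL_Rank"
begin

text \<open>
  A third-order tensor of size \<open>n1 \<times> n2 \<times> n3\<close> is the list of its \<open>n3\<close> frontal slices.
  All indices are 0-based: \<open>A ! k $$ (i, j)\<close> is the entry with (1-based) indices
  \<open>i + 1, j + 1, k + 1\<close>.
\<close>

type_synonym ctensor = "complex mat list"

definition tensors :: "nat \<Rightarrow> nat \<Rightarrow> nat \<Rightarrow> ctensor set" where
  "tensors n1 n2 n3 = {A. length A = n3 \<and> (\<forall>i<n3. A ! i \<in> carrier_mat n1 n2)}"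

text \<open>With 0-based \<open>j\<close>, \<open>k\<close> the angle \<open>(j-1)(2k-1)\<pi>/(2n)\<close> becomes \<open>j(2k+1)\<pi>/(2n)\<close>.\<close>

definition dct_mat :: "nat \<Rightarrow> complex mat" where
  "dct_mat n = mat n n (\<lambda>(j, k). complex_of_real
     (sqrt ((2 - (if j = 0 then 1 else 0)) / real n)
        * cos (real j * (2 * real k + 1) * pi / (2 * real n))))"

definition W_mat :: "nat \<Rightarrow> complex mat" where
  "W_mat n = mat_diag n (\<lambda>j. dct_mat n $$ (j, 0))"

definition Z_mat :: "nat \<Rightarrow> complex mat" where
  "Z_mat n = mat n n (\<lambda>(j, k). if k = j + 1 then 1 else 0)"

text \<open>The diagonal of \<^term>\<open>W_mat n\<close> has no zero entry, so \<^const>\<open>mat_inverse\<close> does not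
  return \<^const>\<open>None\<close> here.\<close>

definition M_mat :: "nat \<Rightarrow> complex mat" where
  "M_mat n = the (mat_inverse (W_mat n)) * dct_mat n * (1\<^sub>m n + Z_mat n)"

definition L :: "ctensor \<Rightarrow> ctensor" where
  "L A = map (\<lambda>k. mat (dim_row (A ! k)) (dim_col (A ! k))
            (\<lambda>(i, j). \<Sum>l<length A. M_mat (length A) $$ (k, l) * A ! l $$ (i, j)))
          [0..<length A]"

text \<open>
  The following operations are determined by their images under \<^const>\<open>L\<close>, which is a bijection
  on \<^term>\<open>tensors n1 n2 n3\<close>.
\<close>

definition cprod :: "ctensor \<Rightarrow> ctensor \<Rightarrow> ctensor" (infixl "*\<^sub>c" 70) where
  "A *\<^sub>c B = (THE C. length C = length A \<and>
     (\<forall>i<length A. C ! i \<in> carrier_mat (dim_row (A ! i)) (dim_col (B ! i)) \<and>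
                   L C ! i = L A ! i * L B ! i))"

definition ctranspose :: "ctensor \<Rightarrow> ctensor" ("(_\<^sup>H)" [1000] 999) where
  "A\<^sup>H = (THE C. length C = length A \<and>
     (\<forall>i<length A. C ! i \<in> carrier_mat (dim_col (A ! i)) (dim_row (A ! i)) \<and>
                   L C ! i = mat_adjoint (L A ! i)))"

definition cidentity :: "nat \<Rightarrow> nat \<Rightarrow> ctensor" where
  "cidentity n n3 = (THE C. C \<in> tensors n n n3 \<and> (\<forall>i<n3. L C ! i = 1\<^sub>m n))"

definition is_cinverse :: "nat \<Rightarrow> nat \<Rightarrow> ctensor \<Rightarrow> ctensor \<Rightarrow> bool" where
  "is_cinverse n n3 B X \<longleftrightarrow> B \<in> tensors n n n3 \<and> X \<in> tensors n n n3 \<and>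
     B *\<^sub>c X = cidentity n n3 \<and> X *\<^sub>c B = cidentity n n3"

definition cinvertible :: "nat \<Rightarrow> nat \<Rightarrow> ctensor \<Rightarrow> bool" where
  "cinvertible n n3 B \<longleftrightarrow> (\<exists>X. is_cinverse n n3 B X)"

definition cinverse :: "nat \<Rightarrow> nat \<Rightarrow> ctensor \<Rightarrow> ctensor" where
  "cinverse n n3 B = (THE X. is_cinverse n n3 B X)"

text \<open>The first argument of \<^const>\<open>vec_space.rank\<close> is the number of
  rows.\<close>

definition c_full_rank_decomp ::
    "nat \<Rightarrow> nat \<Rightarrow> nat \<Rightarrow> nat \<Rightarrow> ctensor \<Rightarrow> ctensor \<Rightarrow> ctensor \<Rightarrow> bool" where
  "c_full_rank_decomp n1 n2 n3 r A M N \<longleftrightarrow>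
     M \<in> tensors n1 r n3 \<and> N \<in> tensors r n2 n3 \<and> A = M *\<^sub>c N \<and>
     (\<forall>i<n3. vec_space.rank n1 (L M ! i) = r \<and>
             vec_space.rank r (L N ! i) = r)"

definition is_MP_inverse :: "nat \<Rightarrow> nat \<Rightarrow> nat \<Rightarrow> ctensor \<Rightarrow> ctensor \<Rightarrow> bool" where
  "is_MP_inverse n1 n2 n3 A X \<longleftrightarrow> X \<in> tensors n2 n1 n3 \<and>
     A *\<^sub>c X *\<^sub>c A = A \<and> X *\<^sub>c A *\<^sub>c X = X \<and>
     (A *\<^sub>c X)\<^sup>H = A *\<^sub>c X \<and> (X *\<^sub>c A)\<^sup>H = X *\<^sub>c A"

definition MP_inverse :: "nat \<Rightarrow> nat \<Rightarrow> nat \<Rightarrow> ctensor \<Rightarrow> ctensor" where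
  "MP_inverse n1 n2 n3 A = (THE X. is_MP_inverse n1 n2 n3 A X)"

end

theory Submission
  imports Defs
begin

text \<open>
  The transform \<^const>\<open>L\<close> turns the C-product into the ordinary matrix product of corresponding
  slices, and likewise for the conjugate transpose and the identity. As \<^const>\<open>L\<close> is a
  bijection, every equation between tensors is equivalent to one matrix equation for each slice,
  and a tensor can be constructed by prescribing its transformed slices freely. The theorem thus
  reduces to matrices.

  The bijection comes from the invertibility of \<^term>\<open>M_mat n\<close>. The DCT matrix is orthogonal,
  \<^term>\<open>W_mat n\<close> is diagonal with nonzero diagonal, and \<^term>\<open>1\<^sub>m n + Z_mat n\<close> is unit upper
  triangular. The diagonal entries of \<^term>\<open>W_mat n\<close> are nonzero because the angles
  \<open>j\<pi>/(2n)\<close> with \<open>j < n\<close> lie below \<open>\<pi>/2\<close>.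

  For matrices, let \<open>C = A B\<close> where \<open>A\<close> has full column rank \<open>r\<close> and \<open>B\<close> has full row rank
  \<open>r\<close>. The Gram matrices \<open>A\<^sup>H A\<close> and \<open>B B\<^sup>H\<close> are then invertible, and therefore so is
  \<open>A\<^sup>H C B\<^sup>H = (A\<^sup>H A) (B B\<^sup>H)\<close>. Put \<open>P = (A\<^sup>H A)\<^sup>-\<^sup>1 A\<^sup>H\<close> and \<open>Q = B\<^sup>H (B B\<^sup>H)\<^sup>-\<^sup>1\<close>. Then
  \<open>P\<close> is a left inverse of \<open>A\<close>, \<open>Q\<close> is a right inverse of \<open>B\<close>, and the projections \<open>A P\<close> and
  \<open>Q B\<close> are Hermitian. With \<open>X = Q P\<close> this gives \<open>C X = A P\<close> and \<open>X C = Q B\<close>, from which the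
  four Penrose equations can be read off, and \<open>Q P\<close> is \<open>B\<^sup>H (A\<^sup>H C B\<^sup>H)\<^sup>-\<^sup>1 A\<^sup>H\<close>. These steps are
  \<open>full_rank_factorization_MP_inverse\<close>; the Penrose equations have at most one solution by
  \<open>mat_MP_inverse_unique\<close>.
\<close>

section \<open>Invertibility of the transform matrix\<close>

text \<open>
  With \<open>a = m\<pi>/(2n)\<close> the summands are \<open>cos ((2k + 1) a)\<close>. Multiplying by \<open>2 sin a\<close> makes the sum
  telescope to \<open>sin (2na) = sin (m\<pi>) = 0\<close>, and \<open>sin a\<close> is nonzero because \<open>m\<close> is no multiple
  of \<open>2n\<close>.
\<close>

lemma sum_cos_odd_multiples_eq_0:
  fixes m :: int
  assumes "m \<noteq> 0" and "\<bar>m\<bar> < 2 * int n"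
  shows "(\<Sum>k<n. cos (real_of_int m * ((2 * real k + 1) * pi / (2 * real n)))) = 0"
proof -
  define a where "a = real_of_int m * pi / (2 * real n)"
  have n: "n > 0" using assms by auto
  have sin_a: "sin a \<noteq> 0"
  proof
    assume "sin a = 0"
    then obtain i :: int where "a = of_int i * pi"
      using sin_zero_iff_int2 by blast
    hence "real_of_int m = real_of_int (i * (2 * int n))"
      using n by (simp add: a_def field_simps)
    hence m: "m = i * (2 * int n)" by linarith
    with assms(1) have "1 \<le> \<bar>i\<bar>" by auto
    hence "2 * int n \<le> \<bar>m\<bar>"
      using n m by (simp add: abs_mult)
    with assms(2) show False by simp
  qed
  have step: "cos (real_of_int m * ((2 * real k + 1) * pi / (2 * real n))) * (2 * sin a)
      = sin (2 * real (Suc k) * a) - sin (2 * real k * a)" for k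
  proof -
    define u where "u = 2 * real k * a + a"
    have "real_of_int m * ((2 * real k + 1) * pi / (2 * real n)) = u"
      by (simp add: u_def a_def add_divide_distrib algebra_simps)
    moreover have "2 * real (Suc k) * a = u + a" "2 * real k * a = u - a"
      by (simp_all add: u_def algebra_simps)
    ultimately show ?thesis by (simp only: sin_add sin_diff)
  qed
  have "(\<Sum>k<n. cos (real_of_int m * ((2 * real k + 1) * pi / (2 * real n)))) * (2 * sin a)
      = (\<Sum>k<n. sin (2 * real (Suc k) * a) - sin (2 * real k * a))"
    by (simp only: sum_distrib_right step)
  also have "\<dots> = sin (2 * real n * a) - sin (2 * real 0 * a)"
    by (rule sum_lessThan_telescope)
  also have "\<dots> = 0"
    using n by (simp add: a_def sin_zero_iff_int2)
  finally show ?thesis using sin_a by simp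
qed

text \<open>
  The product formula for cosines turns each summand into cosines with the multipliers \<open>i - j\<close> and
  \<open>i + j\<close>. Their absolute values stay below \<open>2n\<close>, so their sums vanish unless the multiplier is 0.
  For \<open>i = j = 0\<close> both multipliers are 0, hence the doubled value there.
\<close>

lemma sum_cos_mult_cos:
  assumes "i < n" and "j < n"
  shows "(\<Sum>k<n. cos (real i * (2 * real k + 1) * pi / (2 * real n))
                * cos (real j * (2 * real k + 1) * pi / (2 * real n)))
       = (if i = j then (if i = 0 then real n else real n / 2) else 0)" (is "?S = _")
proof -
  define s where
    "s m = (\<Sum>k<n. cos (real_of_int m * ((2 * real k + 1) * pi / (2 * real n))))" for m :: int
  have s0: "s 0 = real n" by (simp add: s_def)
  have s: "s m = 0" if "m \<noteq> 0" "\<bar>m\<bar> < 2 * int n" for m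
    unfolding s_def using that by (rule sum_cos_odd_multiples_eq_0)
  have "?S = (\<Sum>k<n. (cos (real_of_int (int i - int j) * ((2 * real k + 1) * pi / (2 * real n)))
                 + cos (real_of_int (int i + int j) * ((2 * real k + 1) * pi / (2 * real n)))) / 2)"
    by (intro sum.cong refl, subst cos_times_cos) (simp add: algebra_simps diff_divide_distrib add_divide_distrib)
  also have "\<dots> = (s (int i - int j) + s (int i + int j)) / 2"
    unfolding s_def sum.distrib[symmetric] sum_divide_distrib ..
  finally show ?thesis
    using assms s0 s[of "int i - int j"] s[of "int i + int j"] by auto
qed

lemma dct_mat_carrier [simp]: "dct_mat n \<in> carrier_mat n n"
  by (simp add: dct_mat_def)

lemma dct_mat_orthogonal: "dct_mat n * transpose_mat (dct_mat n) = 1\<^sub>m n"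
proof (rule eq_matI)
  fix i j assume "i < dim_row (1\<^sub>m n :: complex mat)" "j < dim_col (1\<^sub>m n :: complex mat)"
  hence ij: "i < n" "j < n" by auto
  define c where "c j = sqrt ((2 - (if j = 0 then 1 else 0)) / real n)" for j :: nat
  define t where "t j k = cos (real j * (2 * real k + 1) * pi / (2 * real n))" for j k :: nat
  have "(dct_mat n * transpose_mat (dct_mat n)) $$ (i, j)
      = (\<Sum>k<n. complex_of_real (c i * t i k) * complex_of_real (c j * t j k))"
    using ij by (simp add: dct_mat_def scalar_prod_def c_def t_def atLeast0LessThan)
  also have "\<dots> = complex_of_real (c i * c j * (\<Sum>k<n. t i k * t j k))"
    by (simp add: sum_distrib_left mult_ac)
  also have "c i * c j * (\<Sum>k<n. t i k * t j k) = (if i = j then 1 else 0)"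
    unfolding t_def sum_cos_mult_cos[OF ij] using ij
    by (auto simp: c_def field_simps)
  finally show "(dct_mat n * transpose_mat (dct_mat n)) $$ (i, j) = 1\<^sub>m n $$ (i, j)"
    using ij by simp
qed (simp_all add: dct_mat_def)

lemma det_dct_mat: "det (dct_mat n) \<noteq> 0"
proof
  assume "det (dct_mat n) = 0"
  hence "det (dct_mat n * transpose_mat (dct_mat n)) = 0"
    by (subst det_mult[of _ n]) auto
  thus False by (simp add: dct_mat_orthogonal)
qed

lemma dct_mat_first_col_nonzero:
  assumes "j < n"
  shows "dct_mat n $$ (j, 0) \<noteq> 0"
proof -
  have "real j * pi / (2 * real n) < pi / 2"
    using assms by (simp add: field_simps)
  moreover have "0 \<le> real j * pi / (2 * real n)" by simp
  ultimately have "cos (real j * pi / (2 * real n)) > 0"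
    by (intro cos_gt_zero_pi) (use pi_gt_zero in linarith)+
  thus ?thesis using assms by (auto simp: dct_mat_def)
qed

text \<open>
  This justifies the use of \<^const>\<open>the\<close> in the definition of \<^const>\<open>M_mat\<close>.
\<close>

lemma W_mat_inverse:
  obtains V where "mat_inverse (W_mat n) = Some V" "V \<in> carrier_mat n n" "V * W_mat n = 1\<^sub>m n"
proof -
  let ?V = "mat_diag n (\<lambda>j. 1 / dct_mat n $$ (j, 0))"
  have W: "W_mat n \<in> carrier_mat n n" by (simp add: W_mat_def)
  have diag: "W_mat n * ?V = mat_diag n (\<lambda>j. dct_mat n $$ (j, 0) * (1 / dct_mat n $$ (j, 0)))"
    "?V * W_mat n = mat_diag n (\<lambda>j. 1 / dct_mat n $$ (j, 0) * dct_mat n $$ (j, 0))"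
    unfolding W_mat_def by (rule mat_diag_diag)+
  have "W_mat n * ?V = 1\<^sub>m n" "?V * W_mat n = 1\<^sub>m n"
    unfolding diag by (auto simp: mat_diag_def dct_mat_first_col_nonzero)
  hence "W_mat n \<in> Units (ring_mat TYPE(complex) n ())"
    using W unfolding Units_def by (auto simp: ring_mat_def intro!: bexI[of _ ?V])
  hence "mat_inverse (W_mat n) \<noteq> None" using mat_inverse(1)[OF W, where b = "()"] by blast
  then obtain V where "mat_inverse (W_mat n) = Some V" by blast
  with mat_inverse(2)[OF W this] that show ?thesis by blast
qed

lemma M_mat_inverse:
  obtains P where "P \<in> carrier_mat n n" "M_mat n \<in> carrier_mat n n"
    "P * M_mat n = 1\<^sub>m n" "M_mat n * P = 1\<^sub>m n"
proof -
  obtain V where V: "mat_inverse (W_mat n) = Some V" "V \<in> carrier_mat n n"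
    "V * W_mat n = 1\<^sub>m n" by (rule W_mat_inverse)
  have W: "W_mat n \<in> carrier_mat n n" by (simp add: W_mat_def)
  have "det V * det (W_mat n) = 1"
    using det_mult[OF V(2) W] V(3) by simp
  hence detV: "det V \<noteq> 0" by auto
  have Z: "1\<^sub>m n + Z_mat n \<in> carrier_mat n n" by (simp add: Z_mat_def)
  have "upper_triangular (1\<^sub>m n + Z_mat n)"
    by (auto simp: Z_mat_def)
  hence "det (1\<^sub>m n + Z_mat n) = prod_list (diag_mat (1\<^sub>m n + Z_mat n))"
    using Z by (rule det_upper_triangular)
  also have "diag_mat (1\<^sub>m n + Z_mat n) = replicate n 1"
    by (auto simp: diag_mat_def Z_mat_def intro!: nth_equalityI)
  finally have detZ: "det (1\<^sub>m n + Z_mat n) \<noteq> 0" by simp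
  have M: "M_mat n = V * dct_mat n * (1\<^sub>m n + Z_mat n)" by (simp add: M_mat_def V(1))
  have cM: "M_mat n \<in> carrier_mat n n" unfolding M
    by (rule mult_carrier_mat[OF mult_carrier_mat[OF V(2) dct_mat_carrier] Z])
  have "det (M_mat n) = det V * det (dct_mat n) * det (1\<^sub>m n + Z_mat n)"
    unfolding M det_mult[OF mult_carrier_mat[OF V(2) dct_mat_carrier] Z]
      det_mult[OF V(2) dct_mat_carrier] ..
  hence "det (M_mat n) \<noteq> 0" using detV detZ det_dct_mat by simp
  from det_non_zero_imp_unit[OF cM this, of "()"] cM that show ?thesis
    by (auto simp: Units_def ring_mat_def)
qed

section \<open>The transform is a bijection on tensors\<close>

text \<open>
  The mode-3 product with an arbitrary matrix. \<^const>\<open>L\<close> is the case of the matrix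
  \<^const>\<open>M_mat\<close>; having the matrix as a parameter makes the inverse of \<^const>\<open>L\<close> available as
  the mode-3 product with the inverse matrix.
\<close>

definition mode3_prod :: "complex mat \<Rightarrow> ctensor \<Rightarrow> ctensor" where
  "mode3_prod P A = map (\<lambda>k. mat (dim_row (A ! k)) (dim_col (A ! k))
            (\<lambda>(i, j). \<Sum>l<length A. P $$ (k, l) * A ! l $$ (i, j)))
          [0..<length A]"

lemma L_eq_mode3_prod: "A \<in> tensors n1 n2 n \<Longrightarrow> L A = mode3_prod (M_mat n) A"
  by (simp add: L_def mode3_prod_def tensors_def)

lemma mode3_prod_in_tensors:
  "A \<in> tensors n1 n2 n \<Longrightarrow> mode3_prod P A \<in> tensors n1 n2 n"
  by (auto simp: mode3_prod_def tensors_def)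

lemma L_in_tensors: "A \<in> tensors n1 n2 n \<Longrightarrow> L A \<in> tensors n1 n2 n"
  by (simp add: L_eq_mode3_prod mode3_prod_in_tensors)

lemma tensor_slice_carrier: "A \<in> tensors n1 n2 n \<Longrightarrow> i < n \<Longrightarrow> A ! i \<in> carrier_mat n1 n2"
  by (simp add: tensors_def)

lemma tensor_eqI:
  assumes "A \<in> tensors n1 n2 n" "B \<in> tensors n1 n2 n" "\<And>i. i < n \<Longrightarrow> A ! i = B ! i"
  shows "A = B"
  using assms by (auto simp: tensors_def intro: nth_equalityI)

lemma mode3_prod_index:
  assumes "A \<in> tensors n1 n2 n" "k < n" "i < n1" "j < n2"
  shows "mode3_prod P A ! k $$ (i, j) = (\<Sum>l<n. P $$ (k, l) * A ! l $$ (i, j))"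
proof -
  have "A ! k \<in> carrier_mat n1 n2" "length A = n" using assms by (auto simp: tensors_def)
  thus ?thesis using assms by (auto simp: mode3_prod_def)
qed

lemma mode3_prod_mult:
  assumes P: "P \<in> carrier_mat n n" and Q: "Q \<in> carrier_mat n n" and A: "A \<in> tensors n1 n2 n"
  shows "mode3_prod P (mode3_prod Q A) = mode3_prod (P * Q) A"
proof (rule tensor_eqI)
  have QA: "mode3_prod Q A \<in> tensors n1 n2 n" using A by (rule mode3_prod_in_tensors)
  show l: "mode3_prod P (mode3_prod Q A) \<in> tensors n1 n2 n"
    using QA by (rule mode3_prod_in_tensors)
  show r: "mode3_prod (P * Q) A \<in> tensors n1 n2 n"
    using A by (rule mode3_prod_in_tensors)
  fix k assume k: "k < n"
  show "mode3_prod P (mode3_prod Q A) ! k = mode3_prod (P * Q) A ! k"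
  proof (rule eq_matI)
    fix i j
    assume "i < dim_row (mode3_prod (P * Q) A ! k)" "j < dim_col (mode3_prod (P * Q) A ! k)"
    hence ij: "i < n1" "j < n2" using tensor_slice_carrier[OF r k] by auto
    have "mode3_prod P (mode3_prod Q A) ! k $$ (i, j)
        = (\<Sum>l<n. \<Sum>m<n. P $$ (k, l) * Q $$ (l, m) * A ! m $$ (i, j))"
      using mode3_prod_index[OF QA k ij] mode3_prod_index[OF A _ ij]
      by (simp add: sum_distrib_left mult.assoc)
    also have "\<dots> = (\<Sum>m<n. \<Sum>l<n. P $$ (k, l) * Q $$ (l, m) * A ! m $$ (i, j))"
      by (rule sum.swap)
    also have "\<dots> = (\<Sum>m<n. (P * Q) $$ (k, m) * A ! m $$ (i, j))"
      using P Q k by (simp add: scalar_prod_def sum_distrib_right atLeast0LessThan)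
    also have "\<dots> = mode3_prod (P * Q) A ! k $$ (i, j)"
      using mode3_prod_index[OF A k ij] by simp
    finally show "mode3_prod P (mode3_prod Q A) ! k $$ (i, j)
        = mode3_prod (P * Q) A ! k $$ (i, j)" .
  qed (use tensor_slice_carrier[OF l k] tensor_slice_carrier[OF r k] in auto)
qed

lemma mode3_prod_one:
  assumes A: "A \<in> tensors n1 n2 n"
  shows "mode3_prod (1\<^sub>m n) A = A"
proof (rule tensor_eqI[OF mode3_prod_in_tensors[OF A] A])
  fix k assume k: "k < n"
  note car = tensor_slice_carrier[OF A k] tensor_slice_carrier[OF mode3_prod_in_tensors[OF A] k]
  show "mode3_prod (1\<^sub>m n) A ! k = A ! k"
  proof (rule eq_matI)
    fix i j assume "i < dim_row (A ! k)" "j < dim_col (A ! k)"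
    hence "i < n1" "j < n2" using car by auto
    from mode3_prod_index[OF A k this, of "1\<^sub>m n"]
    have "mode3_prod (1\<^sub>m n) A ! k $$ (i, j)
        = (\<Sum>l<n. (if l = k then A ! l $$ (i, j) else 0))"
      using k by (simp add: if_distrib[of "\<lambda>x. x * _"] cong: if_cong)
    thus "mode3_prod (1\<^sub>m n) A ! k $$ (i, j) = A ! k $$ (i, j)"
      using k by simp
  qed (use car car(2)[of "1\<^sub>m n"] in auto)
qed

lemma L_inj:
  assumes A: "A \<in> tensors n1 n2 n" and B: "B \<in> tensors n1 n2 n"
    and eq: "\<And>i. i < n \<Longrightarrow> L A ! i = L B ! i"
  shows "A = B"
proof -
  obtain P where P: "P \<in> carrier_mat n n" "M_mat n \<in> carrier_mat n n" "P * M_mat n = 1\<^sub>m n"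
    by (rule M_mat_inverse)
  have inv: "mode3_prod P (L C) = C" if "C \<in> tensors n1 n2 n" for C
    using that P by (simp add: L_eq_mode3_prod mode3_prod_mult mode3_prod_one)
  have "L A = L B" by (rule tensor_eqI[OF L_in_tensors[OF A] L_in_tensors[OF B] eq])
  thus ?thesis using inv[OF A] inv[OF B] by metis
qed

text \<open>
  A tensor can be built from any prescribed family of transformed slices. Each operation on tensors
  and the inverse in the theorem are obtained in this way.
\<close>

lemma L_surj:
  assumes "\<And>i. i < n \<Longrightarrow> F i \<in> carrier_mat n1 n2"
  obtains C where "C \<in> tensors n1 n2 n" "\<And>i. i < n \<Longrightarrow> L C ! i = F i"
proof -
  obtain P where P: "P \<in> carrier_mat n n" "M_mat n \<in> carrier_mat n n" "M_mat n * P = 1\<^sub>m n"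
    by (rule M_mat_inverse)
  let ?B = "map F [0..<n]"
  have B: "?B \<in> tensors n1 n2 n" using assms by (auto simp: tensors_def)
  have "L (mode3_prod P ?B) = ?B"
    using L_eq_mode3_prod[OF mode3_prod_in_tensors[OF B, of P]] mode3_prod_mult[OF P(2,1) B]
      mode3_prod_one[OF B] P(3) by simp
  with that[OF mode3_prod_in_tensors[OF B, of P]] show ?thesis by simp
qed

section \<open>The tensor operations slice by slice\<close>

text \<open>
  By \<open>L_surj\<close> and \<open>L_inj\<close> exactly one tensor meets the defining condition, so the definite
  description denotes it. The same argument serves for the conjugate transpose and the identity.
\<close>

lemma cprod_slices:
  assumes A: "A \<in> tensors n1 n2 n" and B: "B \<in> tensors n2 n4 n"
  shows cprod_in_tensors: "A *\<^sub>c B \<in> tensors n1 n4 n"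
    and L_cprod: "\<And>i. i < n \<Longrightarrow> L (A *\<^sub>c B) ! i = L A ! i * L B ! i"
proof -
  let ?Q = "\<lambda>C. C \<in> tensors n1 n4 n \<and> (\<forall>i<n. L C ! i = L A ! i * L B ! i)"
  have "L A ! i * L B ! i \<in> carrier_mat n1 n4" if "i < n" for i
    using tensor_slice_carrier[OF L_in_tensors[OF A] that]
      tensor_slice_carrier[OF L_in_tensors[OF B] that] by simp
  then obtain C where "?Q C"
    using L_surj[of n "\<lambda>i. L A ! i * L B ! i" n1 n4] by metis
  moreover have "C' = C''" if "?Q C'" "?Q C''" for C' C''
    using that L_inj[of C' n1 n4 n C''] by simp
  ultimately have "\<exists>!C. ?Q C" by blast
  moreover have "A *\<^sub>c B = (THE C. ?Q C)"
  proof -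
    have len: "length A = n"
      and dims: "\<And>i. i < n \<Longrightarrow> dim_row (A ! i) = n1" "\<And>i. i < n \<Longrightarrow> dim_col (B ! i) = n4"
      using A B by (auto simp: tensors_def)
    have "(length C = length A \<and>
     (\<forall>i<length A. C ! i \<in> carrier_mat (dim_row (A ! i)) (dim_col (B ! i)) \<and>
                   L C ! i = L A ! i * L B ! i)) \<longleftrightarrow> ?Q C" for C
      by (auto simp: tensors_def len dims)
    thus ?thesis unfolding cprod_def by simp
  qed
  ultimately have "?Q (A *\<^sub>c B)" using theI'[of ?Q] by simp
  thus "A *\<^sub>c B \<in> tensors n1 n4 n"
    and "\<And>i. i < n \<Longrightarrow> L (A *\<^sub>c B) ! i = L A ! i * L B ! i" by auto
qed

lemma mat_adjoint_carrier [simp]: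
  "A \<in> carrier_mat n m \<Longrightarrow> mat_adjoint A \<in> carrier_mat m n"
  by (auto simp: mat_adjoint_def mat_of_rows_def)

lemma ctranspose_slices:
  assumes A: "A \<in> tensors n1 n2 n"
  shows ctranspose_in_tensors: "A\<^sup>H \<in> tensors n2 n1 n"
    and L_ctranspose: "\<And>i. i < n \<Longrightarrow> L (A\<^sup>H) ! i = mat_adjoint (L A ! i)"
proof -
  let ?Q = "\<lambda>C. C \<in> tensors n2 n1 n \<and> (\<forall>i<n. L C ! i = mat_adjoint (L A ! i))"
  have "mat_adjoint (L A ! i) \<in> carrier_mat n2 n1" if "i < n" for i
    using tensor_slice_carrier[OF L_in_tensors[OF A] that] by simp
  then obtain C where "?Q C"
    using L_surj[of n "\<lambda>i. mat_adjoint (L A ! i)" n2 n1] by metis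
  moreover have "C' = C''" if "?Q C'" "?Q C''" for C' C''
    using that L_inj[of C' n2 n1 n C''] by simp
  ultimately have "\<exists>!C. ?Q C" by blast
  moreover have "A\<^sup>H = (THE C. ?Q C)"
  proof -
    have len: "length A = n"
      and dims: "\<And>i. i < n \<Longrightarrow> dim_row (A ! i) = n1" "\<And>i. i < n \<Longrightarrow> dim_col (A ! i) = n2"
      using A by (auto simp: tensors_def)
    have "(length C = length A \<and>
     (\<forall>i<length A. C ! i \<in> carrier_mat (dim_col (A ! i)) (dim_row (A ! i)) \<and>
                   L C ! i = mat_adjoint (L A ! i))) \<longleftrightarrow> ?Q C" for C
      by (auto simp: tensors_def len dims)
    thus ?thesis unfolding ctranspose_def by simp
  qed
  ultimately have "?Q (A\<^sup>H)" using theI'[of ?Q] by simp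
  thus "A\<^sup>H \<in> tensors n2 n1 n"
    and "\<And>i. i < n \<Longrightarrow> L (A\<^sup>H) ! i = mat_adjoint (L A ! i)" by auto
qed

lemma cidentity_slices:
  shows cidentity_in_tensors: "cidentity m n \<in> tensors m m n"
    and L_cidentity: "\<And>i. i < n \<Longrightarrow> L (cidentity m n) ! i = 1\<^sub>m m"
proof -
  let ?Q = "\<lambda>C. C \<in> tensors m m n \<and> (\<forall>i<n. L C ! i = 1\<^sub>m m)"
  obtain C where "?Q C"
    using L_surj[of n "\<lambda>i. 1\<^sub>m m" m m] by (metis one_carrier_mat)
  moreover have "C' = C''" if "?Q C'" "?Q C''" for C' C''
    using that L_inj[of C' m m n C''] by simp
  ultimately have "\<exists>!C. ?Q C" by blast
  hence "?Q (cidentity m n)" unfolding cidentity_def by (rule theI')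
  thus "cidentity m n \<in> tensors m m n"
    and "\<And>i. i < n \<Longrightarrow> L (cidentity m n) ! i = 1\<^sub>m m" by auto
qed

lemma tensor_eq_iff_L:
  assumes "A \<in> tensors n1 n2 n" "B \<in> tensors n1 n2 n"
  shows "A = B \<longleftrightarrow> (\<forall>i<n. L A ! i = L B ! i)"
  using assms L_inj by blast

lemma is_cinverse_iff_slices:
  assumes B: "B \<in> tensors m m n" and X: "X \<in> tensors m m n"
  shows "is_cinverse m n B X \<longleftrightarrow>
    (\<forall>i<n. L B ! i * L X ! i = 1\<^sub>m m \<and> L X ! i * L B ! i = 1\<^sub>m m)"
  unfolding is_cinverse_def
    tensor_eq_iff_L[OF cprod_in_tensors[OF B X] cidentity_in_tensors]
    tensor_eq_iff_L[OF cprod_in_tensors[OF X B] cidentity_in_tensors]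
  using B X by (auto simp: L_cprod[OF B X] L_cprod[OF X B] L_cidentity)

section \<open>Matrices of full rank and their Moore-Penrose inverses\<close>

lemma mat_adjoint_index [simp]:
  "i < dim_col A \<Longrightarrow> j < dim_row A \<Longrightarrow> mat_adjoint A $$ (i, j) = conjugate (A $$ (j, i))"
  by (simp add: mat_adjoint_def mat_of_rows_def)

lemma mat_adjoint_dim [simp]:
  "dim_row (mat_adjoint A) = dim_col A" "dim_col (mat_adjoint A) = dim_row A"
  by (simp_all add: mat_adjoint_def mat_of_rows_def)

lemma mat_adjoint_adjoint [simp]: "mat_adjoint (mat_adjoint A) = A"
  by (rule eq_matI) auto

lemma mat_adjoint_one [simp]: "mat_adjoint (1\<^sub>m n) = (1\<^sub>m n :: complex mat)"
  by (rule eq_matI) auto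

lemma mat_adjoint_mult:
  fixes A B :: "complex mat"
  assumes "A \<in> carrier_mat n m" "B \<in> carrier_mat m k"
  shows "mat_adjoint (A * B) = mat_adjoint B * mat_adjoint A"
  using assms
  by (intro eq_matI)
    (auto simp: scalar_prod_def sum_conjugate conjugate_dist_mul mult.commute intro!: sum.cong)

lemma adjoint_cscalar_prod:
  fixes A :: "complex mat"
  assumes A: "A \<in> carrier_mat n m" and v: "v \<in> carrier_vec m" and w: "w \<in> carrier_vec n"
  shows "(A *\<^sub>v v) \<bullet>c w = v \<bullet>c (mat_adjoint A *\<^sub>v w)"
proof -
  have "(A *\<^sub>v v) \<bullet>c w = (\<Sum>i<n. \<Sum>j<m. A $$ (i, j) * v $ j * conjugate (w $ i))"
    using assms by (simp add: scalar_prod_def sum_distrib_right atLeast0LessThan)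
  also have "\<dots> = (\<Sum>j<m. \<Sum>i<n. A $$ (i, j) * v $ j * conjugate (w $ i))"
    by (rule sum.swap)
  also have "\<dots> = v \<bullet>c (mat_adjoint A *\<^sub>v w)"
    using assms by (simp add: scalar_prod_def sum_distrib_left atLeast0LessThan mult_ac)
  finally show ?thesis .
qed

text \<open>
  If \<open>A\<^sup>H A v = 0\<close> then the inner product of \<open>A v\<close> with itself, which is the one of \<open>v\<close> with
  \<open>A\<^sup>H A v\<close>, is 0. So \<open>A v = 0\<close>, and \<open>v = 0\<close> by injectivity.
\<close>

lemma gram_matrix_invertible:
  fixes A :: "complex mat"
  assumes A: "A \<in> carrier_mat n m"
    and inj: "\<And>v. v \<in> carrier_vec m \<Longrightarrow> A *\<^sub>v v = 0\<^sub>v n \<Longrightarrow> v = 0\<^sub>v m"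
  obtains G where "G \<in> carrier_mat m m" "mat_adjoint A * A * G = 1\<^sub>m m" "G * (mat_adjoint A * A) = 1\<^sub>m m"
proof -
  have AA: "mat_adjoint A * A \<in> carrier_mat m m"
    using mult_carrier_mat[OF mat_adjoint_carrier[OF A] A] .
  have "det (mat_adjoint A * A) \<noteq> 0"
  proof
    assume "det (mat_adjoint A * A) = 0"
    then obtain v where v: "v \<in> carrier_vec m" "v \<noteq> 0\<^sub>v m"
      and 0: "(mat_adjoint A * A) *\<^sub>v v = 0\<^sub>v m"
      using det_0_iff_vec_prod_zero_field[OF AA] by blast
    have Av: "A *\<^sub>v v \<in> carrier_vec n" using A v by simp
    have "(A *\<^sub>v v) \<bullet>c (A *\<^sub>v v) = v \<bullet>c (mat_adjoint A *\<^sub>v (A *\<^sub>v v))"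
      by (rule adjoint_cscalar_prod[OF A v(1) Av])
    also have "mat_adjoint A *\<^sub>v (A *\<^sub>v v) = 0\<^sub>v m"
      using 0 assoc_mult_mat_vec[OF mat_adjoint_carrier[OF A] A v(1)] by simp
    finally have "A *\<^sub>v v = 0\<^sub>v n" using v(1) conjugate_square_eq_0_vec[OF Av] by simp
    with inj v show False by blast
  qed
  from det_non_zero_imp_unit[OF AA this, of "()"] AA that show ?thesis
    by (auto simp: Units_def ring_mat_def)
qed

text \<open>
  The rank speaks of the set of columns, so a repeated column has to be excluded first: it would
  leave fewer than \<open>nc\<close> columns to choose an independent set from. After that, a nontrivial kernel
  vector would be a linear dependency of the columns.
\<close>

lemma (in vec_space) full_col_rank_kernel_trivial:
  assumes A: "A \<in> carrier_mat n nc" and rank: "rank A = nc"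
    and v: "v \<in> carrier_vec nc" "A *\<^sub>v v = 0\<^sub>v n"
  shows "v = 0\<^sub>v nc"
proof -
  have "distinct (cols A)"
  proof (rule ccontr)
    assume nd: "\<not> distinct (cols A)"
    obtain S where S: "maximal S (\<lambda>T. T \<subseteq> set (cols A) \<and> lin_indpt T)"
      using maximal_exists[of "(\<lambda>T. T \<subseteq> set (cols A) \<and> lin_indpt T)" "card (set (cols A))" "{}"]
      by (meson List.finite_set card_mono empty_iff empty_subsetI finite_lin_indpt2 rev_finite_subset)
    hence "card S \<le> card (set (cols A))" by (simp add: card_mono maximal_def)
    also have "\<dots> < length (cols A)"
      using nd card_distinct card_length le_neq_implies_less by blast
    finally show False using rank_card_indpt[OF A S] rank A by simp
  qed
  with A v lin_depI[OF A v(1) _ v(2)] full_rank_lin_indpt[OF A rank] show ?thesis by blast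
qed

text \<open>
  A maximal independent set of columns has \<open>n\<close> elements, so it is a basis of the whole space.
\<close>

lemma (in vec_space) full_row_rank_surj:
  assumes A: "A \<in> carrier_mat n nc" and rank: "rank A = n" and w: "w \<in> carrier_vec n"
  obtains x where "x \<in> carrier_vec nc" "A *\<^sub>v x = w"
proof -
  have cols: "set (cols A) \<subseteq> carrier_vec n" using A cols_dim by blast
  obtain S where S: "maximal S (\<lambda>T. T \<subseteq> set (cols A) \<and> lin_indpt T)"
    using maximal_exists[of "(\<lambda>T. T \<subseteq> set (cols A) \<and> lin_indpt T)" "card (set (cols A))" "{}"]
    by (meson List.finite_set card_mono empty_iff empty_subsetI finite_lin_indpt2 rev_finite_subset)
  hence sub: "S \<subseteq> set (cols A)" and li: "lin_indpt S" by (auto simp: maximal_def)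
  have "card S = n" using rank_card_indpt[OF A S] rank by simp
  hence "basis S"
    using sub li cols finite_subset[OF sub]
    by (intro dim_li_is_basis) (auto simp: dim_is_n)
  hence "carrier_vec n = span S" by (simp add: basis_def)
  also have "\<dots> \<subseteq> col_space A" unfolding col_space_def using sub by (rule span_is_monotone)
  finally have "w \<in> col_space A" using w by blast
  thus ?thesis using that A col_space_eq[OF A] by auto
qed

lemma full_col_rank_gram_invertible:
  fixes A :: "complex mat"
  assumes A: "A \<in> carrier_mat n r"
    and rank: "vec_space.rank n A = r"
  obtains G where "G \<in> carrier_mat r r" "mat_adjoint A * A * G = 1\<^sub>m r" "G * (mat_adjoint A * A) = 1\<^sub>m r"
  using gram_matrix_invertible[OF A vec_space.full_col_rank_kernel_trivial[OF A rank]] by blast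

text \<open>
  This is \<open>gram_matrix_invertible\<close> for \<open>A\<^sup>H\<close>, which is injective: a vector \<open>w\<close> in its kernel is
  orthogonal to the range of \<open>A\<close>, which by full row rank contains \<open>w\<close> itself.
\<close>

lemma full_row_rank_gram_invertible:
  fixes A :: "complex mat"
  assumes A: "A \<in> carrier_mat r n"
    and rank: "vec_space.rank r A = r"
  obtains G where "G \<in> carrier_mat r r" "A * mat_adjoint A * G = 1\<^sub>m r" "G * (A * mat_adjoint A) = 1\<^sub>m r"
proof -
  have AH: "mat_adjoint A \<in> carrier_mat n r" using A by simp
  have inj: "w = 0\<^sub>v r" if w: "w \<in> carrier_vec r" and 0: "mat_adjoint A *\<^sub>v w = 0\<^sub>v n" for w
  proof -
    obtain x where x: "x \<in> carrier_vec n" "A *\<^sub>v x = w"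
      using vec_space.full_row_rank_surj[OF A rank w] by blast
    have "w \<bullet>c w = x \<bullet>c (mat_adjoint A *\<^sub>v w)"
      using adjoint_cscalar_prod[OF A x(1) w] x(2) by simp
    also have "\<dots> = 0" using 0 x(1) by simp
    finally show ?thesis using conjugate_square_eq_0_vec[OF w] by simp
  qed
  from gram_matrix_invertible[OF AH inj] that show ?thesis by auto
qed

definition mat_MP_inverse :: "complex mat \<Rightarrow> complex mat \<Rightarrow> bool" where
  "mat_MP_inverse A X \<longleftrightarrow> A * X * A = A \<and> X * A * X = X \<and>
     mat_adjoint (A * X) = A * X \<and> mat_adjoint (X * A) = X * A"

text \<open>
  Penrose's argument. Since \<open>AX = (AY)(AX)\<close> and all of these are Hermitian, taking adjoints gives
  \<open>AX = (AX)(AY) = AY\<close>. In the same way \<open>XA = YA\<close>, and then \<open>X = XAX = YAY = Y\<close>.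
\<close>

lemma mat_MP_inverse_unique:
  fixes A :: "complex mat"
  assumes A: "A \<in> carrier_mat n m" and X: "X \<in> carrier_mat m n" and Y: "Y \<in> carrier_mat m n"
    and mpX: "mat_MP_inverse A X" and mpY: "mat_MP_inverse A Y"
  shows "X = Y"
proof -
  note x = mpX[unfolded mat_MP_inverse_def] and y = mpY[unfolded mat_MP_inverse_def]
  have AX: "A * X \<in> carrier_mat n n" and AY: "A * Y \<in> carrier_mat n n"
    and XA: "X * A \<in> carrier_mat m m" and YA: "Y * A \<in> carrier_mat m m"
    using A X Y by auto
  have "A * X = (A * Y) * (A * X)"
    using y A X AY assoc_mult_mat[OF AY A X] by simp
  also have "\<dots> = mat_adjoint ((A * X) * (A * Y))"
    using x y mat_adjoint_mult[OF AX AY] by simp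
  also have "(A * X) * (A * Y) = A * Y"
    using x assoc_mult_mat[OF AX A Y] by simp
  finally have 1: "A * X = A * Y" using y by simp
  have "X * A = (X * A) * (Y * A)"
    using y assoc_mult_mat[OF X A YA] assoc_mult_mat[OF A Y A] by simp
  also have "\<dots> = mat_adjoint ((Y * A) * (X * A))"
    using x y mat_adjoint_mult[OF YA XA] by simp
  also have "(Y * A) * (X * A) = Y * A"
    using x assoc_mult_mat[OF Y A XA] assoc_mult_mat[OF A X A] by simp
  finally have 2: "X * A = Y * A" using y by simp
  have "X = X * (A * X)" using x assoc_mult_mat[OF X A X] by simp
  also have "\<dots> = (Y * A) * Y" using 1 2 assoc_mult_mat[OF X A Y] by simp
  finally show ?thesis using y by simp
qed

lemma adjoint_inverse_of_hermitian:
  fixes G H :: "complex mat"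
  assumes G: "G \<in> carrier_mat n n" and H: "H \<in> carrier_mat n n"
    and herm: "mat_adjoint H = H" and inv: "H * G = 1\<^sub>m n" "G * H = 1\<^sub>m n"
  shows "mat_adjoint G = G"
proof -
  have "mat_adjoint G * H = 1\<^sub>m n"
    using mat_adjoint_mult[OF H G] herm inv(1) by simp
  hence "mat_adjoint G = mat_adjoint G * H * G"
    using assoc_mult_mat[OF mat_adjoint_carrier[OF G] H G] inv(1) G by simp
  also have "\<dots> = G" using \<open>mat_adjoint G * H = 1\<^sub>m n\<close> G by simp
  finally show ?thesis .
qed

text \<open>
  The one-sided inverses cancel in the middle: \<open>(A B) (Q P) = A P\<close> and \<open>(Q P) (A B) = Q B\<close>. All
  four Penrose equations follow from these two identities.
\<close>

lemma mat_MP_inverse_one_sided: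
  fixes A B P Q :: "complex mat"
  assumes A: "A \<in> carrier_mat n r" and B: "B \<in> carrier_mat r m"
    and P: "P \<in> carrier_mat r n" and Q: "Q \<in> carrier_mat m r"
    and PA: "P * A = 1\<^sub>m r" and BQ: "B * Q = 1\<^sub>m r"
    and AP: "mat_adjoint (A * P) = A * P" and QB: "mat_adjoint (Q * B) = Q * B"
  shows "mat_MP_inverse (A * B) (Q * P)"
proof -
  have AB: "A * B \<in> carrier_mat n m" and QP: "Q * P \<in> carrier_mat m n" using A B P Q by auto
  have 1: "A * B * (Q * P) = A * P"
  proof -
    have "A * B * (Q * P) = A * (B * Q * P)"
      using assoc_mult_mat[OF A B QP] assoc_mult_mat[OF B Q P] by simp
    thus ?thesis using BQ P by simp
  qed
  have 2: "Q * P * (A * B) = Q * B"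
  proof -
    have "Q * P * (A * B) = Q * (P * A * B)"
      using assoc_mult_mat[OF Q P AB] assoc_mult_mat[OF P A B] by simp
    thus ?thesis using PA B by simp
  qed
  have 3: "A * P * (A * B) = A * B"
  proof -
    have "A * P * (A * B) = A * (P * A * B)"
      using assoc_mult_mat[OF A P AB] assoc_mult_mat[OF P A B] by simp
    thus ?thesis using PA B by simp
  qed
  have 4: "Q * B * (Q * P) = Q * P"
  proof -
    have "Q * B * (Q * P) = Q * (B * Q * P)"
      using assoc_mult_mat[OF Q B QP] assoc_mult_mat[OF B Q P] by simp
    thus ?thesis using BQ P by simp
  qed
  show ?thesis unfolding mat_MP_inverse_def 1 2 3 4 using AP QB by simp
qed

text \<open>
  With \<open>G\<close> and \<open>H\<close> the inverses of the Gram matrices \<open>A\<^sup>H A\<close> and \<open>B B\<^sup>H\<close>, the previous lemma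
  applies to \<open>P = G A\<^sup>H\<close> and \<open>Q = B\<^sup>H H\<close>, and the required \<open>K\<close> is \<open>H G\<close>. The projections \<open>A P\<close> and
  \<open>Q B\<close> are Hermitian because \<open>G\<close> and \<open>H\<close> are.
\<close>

lemma full_rank_factorization_MP_inverse:
  fixes A B :: "complex mat"
  assumes A: "A \<in> carrier_mat n r" and B: "B \<in> carrier_mat r m"
    and rankA: "vec_space.rank n A = r" and rankB: "vec_space.rank r B = r"
  obtains K where "K \<in> carrier_mat r r"
    "mat_adjoint A * (A * B) * mat_adjoint B * K = 1\<^sub>m r"
    "K * (mat_adjoint A * (A * B) * mat_adjoint B) = 1\<^sub>m r"
    "mat_MP_inverse (A * B) (mat_adjoint B * K * mat_adjoint A)"
proof -
  let ?AH = "mat_adjoint A" and ?BH = "mat_adjoint B"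
  have AH: "?AH \<in> carrier_mat r n" and BH: "?BH \<in> carrier_mat m r" using A B by auto
  obtain G where G: "G \<in> carrier_mat r r" "?AH * A * G = 1\<^sub>m r" "G * (?AH * A) = 1\<^sub>m r"
    using full_col_rank_gram_invertible[OF A rankA] by blast
  obtain H where H: "H \<in> carrier_mat r r" "B * ?BH * H = 1\<^sub>m r" "H * (B * ?BH) = 1\<^sub>m r"
    using full_row_rank_gram_invertible[OF B rankB] by blast
  have AA: "?AH * A \<in> carrier_mat r r" and BB: "B * ?BH \<in> carrier_mat r r"
    and AB: "A * B \<in> carrier_mat n m" and GA: "G * ?AH \<in> carrier_mat r n"
    and BHH: "?BH * H \<in> carrier_mat m r" and HG: "H * G \<in> carrier_mat r r"
    using A B AH BH G(1) H(1) by auto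
  have hG: "mat_adjoint G = G"
    by (rule adjoint_inverse_of_hermitian[OF G(1) AA _ G(2,3)])
      (simp add: mat_adjoint_mult[OF AH A])
  have hH: "mat_adjoint H = H"
    by (rule adjoint_inverse_of_hermitian[OF H(1) BB _ H(2,3)])
      (simp add: mat_adjoint_mult[OF B BH])
  have hP: "mat_adjoint (A * (G * ?AH)) = A * (G * ?AH)"
    using mat_adjoint_mult[OF A GA] mat_adjoint_mult[OF G(1) AH] hG
      assoc_mult_mat[OF A G(1) AH] by simp
  have hQ: "mat_adjoint (?BH * H * B) = ?BH * H * B"
    using mat_adjoint_mult[OF BHH B] mat_adjoint_mult[OF BH H(1)] hH
      assoc_mult_mat[OF BH H(1) B] by simp
  have mp: "mat_MP_inverse (A * B) (?BH * H * (G * ?AH))"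
    using assoc_mult_mat[OF G(1) AH A] assoc_mult_mat[OF B BH H(1)] G(3) H(2)
    by (intro mat_MP_inverse_one_sided[OF A B GA BHH _ _ hP hQ]) auto
  have core: "?AH * (A * B) * ?BH = ?AH * A * (B * ?BH)"
    using assoc_mult_mat[OF AH A B] assoc_mult_mat[OF AA B BH] by simp
  have K1: "?AH * A * (B * ?BH) * (H * G) = 1\<^sub>m r"
  proof -
    have "?AH * A * (B * ?BH) * (H * G) = ?AH * A * (B * ?BH * H * G)"
      using assoc_mult_mat[OF AA BB HG] assoc_mult_mat[OF BB H(1) G(1)] by simp
    thus ?thesis using H(2) G(1,2) by simp
  qed
  have K2: "H * G * (?AH * A * (B * ?BH)) = 1\<^sub>m r"
    by (rule mat_mult_left_right_inverse[OF mult_carrier_mat[OF AA BB] HG K1])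
  have "?BH * H * (G * ?AH) = ?BH * (H * G) * ?AH"
    using assoc_mult_mat[OF BHH G(1) AH] assoc_mult_mat[OF BH H(1) G(1)] by simp
  hence "mat_MP_inverse (A * B) (?BH * (H * G) * ?AH)" using mp by metis
  thus ?thesis by (intro that[OF HG]) (simp_all only: core K1 K2)
qed

section \<open>The tensor Moore-Penrose inverse\<close>

lemma is_MP_inverse_iff_slices:
  assumes A: "A \<in> tensors n1 n2 n" and X: "X \<in> tensors n2 n1 n"
  shows "is_MP_inverse n1 n2 n A X \<longleftrightarrow> (\<forall>i<n. mat_MP_inverse (L A ! i) (L X ! i))"
proof -
  note AX = cprod_in_tensors[OF A X] and XA = cprod_in_tensors[OF X A]
  show ?thesis
    unfolding is_MP_inverse_def
      tensor_eq_iff_L[OF cprod_in_tensors[OF AX A] A] tensor_eq_iff_L[OF cprod_in_tensors[OF XA X] X]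
      tensor_eq_iff_L[OF ctranspose_in_tensors[OF AX] AX]
      tensor_eq_iff_L[OF ctranspose_in_tensors[OF XA] XA]
    using X by (auto simp: mat_MP_inverse_def L_cprod[OF A X] L_cprod[OF X A]
        L_cprod[OF AX A] L_cprod[OF XA X] L_ctranspose[OF AX] L_ctranspose[OF XA])
qed

lemma is_MP_inverse_unique:
  assumes A: "A \<in> tensors n1 n2 n"
    and X: "is_MP_inverse n1 n2 n A X" and Y: "is_MP_inverse n1 n2 n A Y"
  shows "X = Y"
proof -
  have cX: "X \<in> tensors n2 n1 n" and cY: "Y \<in> tensors n2 n1 n"
    using X Y by (auto simp: is_MP_inverse_def)
  show ?thesis
  proof (rule L_inj[OF cX cY])
    fix i assume i: "i < n"
    show "L X ! i = L Y ! i"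
      using X Y i is_MP_inverse_iff_slices[OF A cX] is_MP_inverse_iff_slices[OF A cY]
      by (intro mat_MP_inverse_unique[of "L A ! i" n1 n2])
        (auto intro: tensor_slice_carrier L_in_tensors A cX cY)
  qed
qed

lemma is_cinverse_unique:
  assumes "is_cinverse m n B X" "is_cinverse m n B Y"
  shows "X = Y"
proof -
  have B: "B \<in> tensors m m n" and X: "X \<in> tensors m m n" and Y: "Y \<in> tensors m m n"
    using assms by (auto simp: is_cinverse_def)
  show ?thesis
  proof (rule L_inj[OF X Y])
    fix i assume i: "i < n"
    let ?B = "L B ! i" and ?X = "L X ! i" and ?Y = "L Y ! i"
    have c: "?B \<in> carrier_mat m m" "?X \<in> carrier_mat m m" "?Y \<in> carrier_mat m m"
      using i by (auto intro: tensor_slice_carrier L_in_tensors B X Y)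
    have "?X = ?X * (?B * ?Y)" using assms(2) i c by (simp add: is_cinverse_iff_slices[OF B Y])
    also have "\<dots> = ?X * ?B * ?Y" using assoc_mult_mat[OF c(2,1,3)] by simp
    also have "\<dots> = ?Y" using assms(1) i c by (simp add: is_cinverse_iff_slices[OF B X])
    finally show "?X = ?Y" .
  qed
qed

theorem theorem3p8:
  fixes n1 n2 n3 r :: nat and A M N :: ctensor
  assumes "A \<in> tensors n1 n2 n3"
    and "c_full_rank_decomp n1 n2 n3 r A M N"
  shows "cinvertible r n3 (M\<^sup>H *\<^sub>c A *\<^sub>c N\<^sup>H) \<and>
         (\<exists>!X. is_MP_inverse n1 n2 n3 A X) \<and>
         MP_inverse n1 n2 n3 A = N\<^sup>H *\<^sub>c cinverse r n3 (M\<^sup>H *\<^sub>c A *\<^sub>c N\<^sup>H) *\<^sub>c M\<^sup>H"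
proof -
  let ?B = "M\<^sup>H *\<^sub>c A *\<^sub>c N\<^sup>H"
  have M: "M \<in> tensors n1 r n3" and N: "N \<in> tensors r n2 n3" and MN: "A = M *\<^sub>c N"
    and rank: "\<And>i. i < n3 \<Longrightarrow> vec_space.rank n1 (L M ! i) = r"
      "\<And>i. i < n3 \<Longrightarrow> vec_space.rank r (L N ! i) = r"
    using assms(2) by (auto simp: c_full_rank_decomp_def)
  note MH = ctranspose_in_tensors[OF M] and NH = ctranspose_in_tensors[OF N]
  note MHA = cprod_in_tensors[OF MH assms(1)]
  note B = cprod_in_tensors[OF MHA NH]
  have LA: "L A ! i = L M ! i * L N ! i" if "i < n3" for i
    using that L_cprod[OF M N] MN by simp
  have LB: "L ?B ! i = mat_adjoint (L M ! i) * (L M ! i * L N ! i) * mat_adjoint (L N ! i)"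
    if "i < n3" for i
    using that by (simp add: L_cprod[OF MHA NH] L_cprod[OF MH assms(1)] L_ctranspose[OF M]
        L_ctranspose[OF N] LA)
  have "\<exists>K. K \<in> carrier_mat r r \<and> L ?B ! i * K = 1\<^sub>m r \<and> K * L ?B ! i = 1\<^sub>m r \<and>
      mat_MP_inverse (L A ! i) (mat_adjoint (L N ! i) * K * mat_adjoint (L M ! i))"
    if i: "i < n3" for i
    unfolding LA[OF i] LB[OF i]
    using full_rank_factorization_MP_inverse[OF tensor_slice_carrier[OF L_in_tensors[OF M] i]
      tensor_slice_carrier[OF L_in_tensors[OF N] i] rank(1)[OF i] rank(2)[OF i]] by metis
  then obtain F where F: "\<And>i. i < n3 \<Longrightarrow> F i \<in> carrier_mat r r \<and>
      L ?B ! i * F i = 1\<^sub>m r \<and> F i * L ?B ! i = 1\<^sub>m r \<and>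
      mat_MP_inverse (L A ! i) (mat_adjoint (L N ! i) * F i * mat_adjoint (L M ! i))"
    by metis
  then obtain K where K: "K \<in> tensors r r n3" "\<And>i. i < n3 \<Longrightarrow> L K ! i = F i"
    using L_surj[of n3 F r r] by metis
  have inv: "is_cinverse r n3 ?B K"
    using F K by (simp add: is_cinverse_iff_slices[OF B K(1)])
  hence cinv: "cinverse r n3 ?B = K"
    unfolding cinverse_def using is_cinverse_unique by blast
  let ?X = "N\<^sup>H *\<^sub>c K *\<^sub>c M\<^sup>H"
  note NHK = cprod_in_tensors[OF NH K(1)]
  note X = cprod_in_tensors[OF NHK MH]
  have "is_MP_inverse n1 n2 n3 A ?X"
    using F by (simp add: is_MP_inverse_iff_slices[OF assms(1) X] L_cprod[OF NHK MH]
        L_cprod[OF NH K(1)] L_ctranspose[OF M] L_ctranspose[OF N] K(2))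
  moreover from this have "\<exists>!X. is_MP_inverse n1 n2 n3 A X"
    using is_MP_inverse_unique[OF assms(1)] by blast
  moreover have "cinvertible r n3 ?B" using inv by (auto simp: cinvertible_def)
  ultimately show ?thesis
    unfolding cinv MP_inverse_def using the1_equality by metis
qed

end
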